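(* Let $X$ be a compact metric space, let $\mathcal{L}$ be a transfer operator on $C^0(X,\mathbb{C})$, and let $\mu\in\mathcal{M}$ be such that $\mathcal{L}^*\mu=\mu$. Let $\varphi:X\to\mathbb{R}$ be bounded and measurable. For each natural number $n\ge1$ and each real number $\beta$, denote $$\varphi_n:=\sum_{j=0}^{n-1}\mathcal{L}^j\varphi,\qquad B_\beta:=\Big\{x\in X:\ \inf_{n\ge1}\frac{\varphi_n(x)}{n}<\beta\Big\}.$$ Then, for any real number $\beta$ and any measurable set $A\subset B_\beta$ such that $(\mathcal{L}\chi_A)(x)=\chi_A(x)$ for $\mu$-a.e. $x\in X$, the following inequality holds: $$\int_A\varphi\,d\mu\ \le\ \beta\cdot\mu(A).$$
   Context: $X$ is a compact metric space, $\mathcal{A}$ its Borel sigma-algebra (measurable means with respect to $\mathcal{A}$), $\mathcal{M}$ the set of all probability measures on $(X,\mathcal{A})$, and $C^0(X,\mathbb{C})$ the space of continuous functions $X\to\mathbb{C}$ with the supremum norm. $\chi_A$ denotes the characteristic function of $A$. A transfer operator is a linear operator $\mathcal{L}:C^0(X,\mathbb{C})\to C^0(X,\mathbb{C})$ such that: (1) $\mathcal{L}\varphi$ is real and non-negative whenever $\varphi$ is real and non-negative; (2) $\max_{x\in X}|(\mathcal{L}\varphi)(x)|\le\max_{x\in X}|\varphi(x)|$ for all $\varphi\in C^0(X,\mathbb{C})$, and $\mathcal{L}1=1$. Its dual transfer operator $\mathcal{L}^*:\mathcal{M}\to\mathcal{M}$ is the unique map with $\int\varphi\,d(\mathcal{L}^*\mu)=\int\mathcal{L}\varphi\,d\mu$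 for all $\varphi\in C^0(X,\mathbb{C})$ and $\mu\in\mathcal{M}$. For each $x\in X$, $P(x,\cdot)\in\mathcal{M}$ denotes the unique probability measure with $(\mathcal{L}\varphi)(x)=\int\varphi(y)\,P(x,dy)$ for all $\varphi\in C^0(X,\mathbb{C})$. $L_\infty$ denotes the set of bounded functions $\varphi:X\to\mathbb{C}$ such that for every $\mu\in\mathcal{M}$ there is a measurable function $\varphi_\mu$ that coincides with $\varphi$ $\mu$-a.e.; one puts $\int\varphi\,d\mu:=\int\varphi_\mu\,d\mu$. In particular bounded measurable functions belong to $L_\infty$. The operator $\mathcal{L}$ is extended to $L_\infty$ by $(\mathcal{L}\varphi)(x):=\int\varphi(y)\,P(x,dy)$ for all $x\in X$, $\varphi\in L_\infty$; it maps $L_\infty$ to itself. $\mathcal{L}^j$ is the $j$-th iterate of this extended operator ($\mathcal{L}^0$ is the identity). *)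

theory Defs
  imports "HOL-Probability.Probability"
begin

text \<open>
  The compact metric space $X$ is the universe of a type of class \<^class>\<open>metric_space\<close>, so its
  continuous functions are automatically bounded, and the space $C^0(X, \mathbf{C})$ with the
  supremum norm is the type of bounded continuous functions into the complex numbers.
\<close>

definition cscale :: "complex \<Rightarrow> ('a::topological_space \<Rightarrow>\<^sub>C complex) \<Rightarrow> ('a \<Rightarrow>\<^sub>C complex)" where
  "cscale c f = Bcontfun (\<lambda>x. c * apply_bcontfun f x)"

lemma apply_cscale [simp]: "apply_bcontfun (cscale c f) x = c * apply_bcontfun f x"
proof -
  have "(\<lambda>x. c * apply_bcontfun f x) \<in> bcontfun"
    using bounded_linear_image[OF bounded_apply_bcontfun[of f] bounded_linear_mult_right[of c]]
    by (auto simp: bcontfun_def image_image intro!: continuous_intros)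
  then show ?thesis
    by (simp add: cscale_def Bcontfun_inverse)
qed

lemma vector_space_cscale:
  "vector_space (cscale :: complex \<Rightarrow> ('a::topological_space \<Rightarrow>\<^sub>C complex) \<Rightarrow> _)"
  by standard (auto intro!: bcontfun_eqI simp: algebra_simps)

definition transfer_operator ::
    "(('a::topological_space \<Rightarrow>\<^sub>C complex) \<Rightarrow> ('a \<Rightarrow>\<^sub>C complex)) \<Rightarrow> bool" where
  "transfer_operator L \<longleftrightarrow>
     Vector_Spaces.linear cscale cscale L \<and>
     (\<forall>f. range (apply_bcontfun f) \<subseteq> \<real>\<^sub>\<ge>\<^sub>0 \<longrightarrow> range (apply_bcontfun (L f)) \<subseteq> \<real>\<^sub>\<ge>\<^sub>0) \<and>
     (\<forall>f. norm (L f) \<le> norm f) \<and>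
     L (const_bcontfun 1) = const_bcontfun 1"

definition borel_prob_measures :: "'a::topological_space measure set" where
  "borel_prob_measures = {\<mu>. sets \<mu> = sets borel \<and> prob_space \<mu>}"

text \<open>
  The dual operator and the kernel $P(x, \cdot)$ are the unique measures with the stated
  integrals; their existence and uniqueness for a transfer operator on a compact metric space
  is the Riesz representation theorem.
\<close>

definition dual_transfer_operator ::
    "(('a::topological_space \<Rightarrow>\<^sub>C complex) \<Rightarrow> ('a \<Rightarrow>\<^sub>C complex)) \<Rightarrow> 'a measure \<Rightarrow> 'a measure" where
  "dual_transfer_operator L \<mu> =
     (THE \<nu>. \<nu> \<in> borel_prob_measures \<and>
        (\<forall>f. (\<integral>x. apply_bcontfun f x \<partial>\<nu>) = (\<integral>x. apply_bcontfun (L f) x \<partial>\<mu>)))"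

definition transfer_kernel ::
    "(('a::topological_space \<Rightarrow>\<^sub>C complex) \<Rightarrow> ('a \<Rightarrow>\<^sub>C complex)) \<Rightarrow> 'a \<Rightarrow> 'a measure" where
  "transfer_kernel L x =
     (THE \<nu>. \<nu> \<in> borel_prob_measures \<and>
        (\<forall>f. apply_bcontfun (L f) x = (\<integral>y. apply_bcontfun f y \<partial>\<nu>)))"

definition L_infty :: "('a::topological_space \<Rightarrow> complex) set" where
  "L_infty = {f. bounded (range f) \<and>
     (\<forall>\<mu>\<in>borel_prob_measures. \<exists>g\<in>borel_measurable borel. AE x in \<mu>. f x = g x)}"

text \<open>
  The integral of an element of \<^const>\<open>L_infty\<close>, as the integral of any measurable function
  that coincides with it almost everywhere. The values of this and the next constant outside
  \<^const>\<open>L_infty\<close> are irrelevant.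
\<close>

definition L_infty_integral :: "'a::topological_space measure \<Rightarrow> ('a \<Rightarrow> complex) \<Rightarrow> complex" where
  "L_infty_integral \<mu> f =
     (\<integral>x. (SOME g. g \<in> borel_measurable borel \<and> (AE x in \<mu>. f x = g x)) x \<partial>\<mu>)"

lemma L_infty_integral_eq:
  assumes "\<mu> \<in> borel_prob_measures" "g \<in> borel_measurable borel" "AE x in \<mu>. f x = g x"
  shows "L_infty_integral \<mu> f = (\<integral>x. g x \<partial>\<mu>)"
proof -
  define h where "h = (SOME g. g \<in> borel_measurable borel \<and> (AE x in \<mu>. f x = g x))"
  have h: "h \<in> borel_measurable borel \<and> (AE x in \<mu>. f x = h x)"
    unfolding h_def by (rule someI[of _ g]) (use assms in auto)
  have sets: "sets \<mu> = sets borel"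
    using assms(1) by (simp add: borel_prob_measures_def)
  have "(\<integral>x. h x \<partial>\<mu>) = (\<integral>x. g x \<partial>\<mu>)"
  proof (rule integral_cong_AE)
    show "h \<in> borel_measurable \<mu>" "g \<in> borel_measurable \<mu>"
      using h assms(2) measurable_cong_sets[OF sets refl] by auto
    show "AE x in \<mu>. h x = g x"
      using conjunct2[OF h] assms(3) by eventually_elim simp
  qed
  then show ?thesis
    by (simp add: L_infty_integral_def h_def)
qed

definition extended_transfer_operator ::
    "(('a::topological_space \<Rightarrow>\<^sub>C complex) \<Rightarrow> ('a \<Rightarrow>\<^sub>C complex)) \<Rightarrow> ('a \<Rightarrow> complex) \<Rightarrow> 'a \<Rightarrow> complex" where
  "extended_transfer_operator L f x = L_infty_integral (transfer_kernel L x) f"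

text \<open>
  The sum \<open>\<phi>\<^sub>n\<close>. The iterates of a real-valued function stay real-valued, but they are elements of
  \<^const>\<open>L_infty\<close>, hence complex-valued; \<^const>\<open>Re\<close> only converts the type.
\<close>

definition ergodic_sum ::
    "(('a::topological_space \<Rightarrow>\<^sub>C complex) \<Rightarrow> ('a \<Rightarrow>\<^sub>C complex)) \<Rightarrow> ('a \<Rightarrow> real) \<Rightarrow> nat \<Rightarrow> 'a \<Rightarrow> real" where
  "ergodic_sum L \<phi> n x =
     Re (\<Sum>j<n. (extended_transfer_operator L ^^ j) (\<lambda>y. complex_of_real (\<phi> y)) x)"

definition sublevel_set ::
    "(('a::topological_space \<Rightarrow>\<^sub>C complex) \<Rightarrow> ('a \<Rightarrow>\<^sub>C complex)) \<Rightarrow> ('a \<Rightarrow> real) \<Rightarrow> real \<Rightarrow> 'a set" where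
  "sublevel_set L \<phi> \<beta> = {x. (INF n\<in>{1..}. ergodic_sum L \<phi> n x / real n) < \<beta>}"

end

theory Submission
  imports Defs
begin

text \<open>
  By the Riesz representation theorem the operator \<open>L\<close> averages a function over a measurable family of
  probability measures \<open>P(x, \<cdot>)\<close>, that is, over a Markov kernel; and \<open>L\<^sup>* \<mu> = \<mu>\<close> says that \<open>\<mu>\<close> is
  invariant under this kernel, at first for continuous and then for all bounded measurable functions. The
  claim is now a statement about Markov kernels, namely Hopf's maximal ergodic theorem for the
  function \<open>\<psi> = \<beta> - \<phi>\<close> on an invariant set: every point of \<open>A\<close> has some sum of iterates of \<open>\<psi>\<close> that
  is positive, therefore the integral of \<open>\<psi>\<close> over \<open>A\<close> is not negative.

  The maximal inequality comes from functions \<open>m\<^sub>0 = 0\<close> and \<open>m\<^sub>N\<^sub>+\<^sub>1 = max 0 (\<psi> + L m\<^sub>N)\<close>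
  (\<open>maximal_excess\<close>). They increase with \<open>N\<close>, and \<open>m\<^sub>N\<close> dominates the sums of at most \<open>N\<close> iterates of
  \<open>\<psi>\<close>, so the sets where \<open>m\<^sub>N > 0\<close> exhaust \<open>A\<close>. On such a set \<open>\<psi> = m\<^sub>N - L m\<^sub>N\<^sub>-\<^sub>1\<close>, and off it the
  right-hand side is at most 0. Since \<open>P(x, \<cdot>)\<close> lives on \<open>A\<close> or off \<open>A\<close> according to whether \<open>x\<close> is in
  \<open>A\<close>, for almost every \<open>x\<close>, the functions \<open>L m\<close> and \<open>m\<close> have the same integral over \<open>A\<close>
  (\<open>integral_transition_on_invariant_set\<close>). So the integral of \<open>\<psi>\<close> over the part of \<open>A\<close> where
  \<open>m\<^sub>N > 0\<close> is at least that of \<open>m\<^sub>N - m\<^sub>N\<^sub>-\<^sub>1 \<ge> 0\<close> over \<open>A\<close>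
  (\<open>integral_maximal_excess_pos_set_nonneg\<close>), and \<open>N \<rightarrow> \<infinity>\<close> gives the claim
  (\<open>integral_le_of_ergodic_averages_below\<close>).

  The representing measure is built from the values of the functional on the functions below the
  indicator of an open set, extended to all sets as an outer measure; open sets satisfy Caratheodory's
  criterion (\<open>content_ge_split\<close>), and slicing a function into thin layers shows that the measure
  represents the functional (\<open>riesz_representation\<close>).
\<close>

section \<open>The Riesz representation theorem on a compact metric space\<close>

lemma compact_UNIV_bounded_range:
  fixes f :: "'a::metric_space \<Rightarrow> 'b::metric_space"
  assumes "compact (UNIV :: 'a set)" "continuous_on UNIV f"
  shows "bounded (range f)"
  using assms compact_continuous_image compact_imp_bounded by blast

lemma open_bump_function:
  fixes U :: "'a::metric_space set"
  assumes "open U"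
  shows "\<exists>g :: 'a \<Rightarrow> real. continuous_on UNIV g \<and> (\<forall>x. 0 \<le> g x \<and> g x \<le> 1 \<and> (0 < g x \<longleftrightarrow> x \<in> U))"
proof (cases "U = UNIV")
  case True
  then show ?thesis by (intro exI[of _ "\<lambda>_. 1"]) auto
next
  case False
  have "0 < infdist x (- U) \<longleftrightarrow> x \<in> U" for x
    using False assms in_closed_iff_infdist_zero[of "- U" x] infdist_nonneg[of x "- U"]
    by (auto simp: closed_open less_le)
  then show ?thesis
    by (intro exI[of _ "\<lambda>x. min 1 (infdist x (- U))"])
      (auto intro!: continuous_intros simp: infdist_nonneg)
qed

text \<open>
  The next two lemmas compare a number \<open>t \<ge> 0\<close> with its unit layers: the integral of a function is
  recovered, up to an error of one layer, from the measures of its superlevel sets.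
\<close>
lemma sum_unit_layers:
  fixes t :: real
  assumes "0 \<le> t"
  shows "(\<Sum>k<n. min 1 (max 0 (t - real k))) = min (real n) t"
  using assms by (induction n) auto

lemma sum_of_bool_layers_le:
  fixes t :: real
  assumes "0 \<le> t"
  shows "(\<Sum>k<n. of_bool (real k < t)) \<le> t + 1"
proof (induction n)
  case (Suc n)
  have "(\<Sum>k<n. of_bool (real k < t)) \<le> (\<Sum>k<n. 1 :: real)"
    by (intro sum_mono) auto
  with Suc show ?case by auto
qed (use assms in auto)

text \<open>
  The functional acts on plain functions, and its laws are required for continuous arguments only;
  this spares the conversions to and from the type of bounded continuous functions in the
  construction below, where truncations, quotients and finite sums are formed all the time.
\<close>
locale positive_unital_functional =
  fixes \<Lambda> :: "('a::metric_space \<Rightarrow> real) \<Rightarrow> real"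
  assumes compact_UNIV: "compact (UNIV :: 'a set)"
    and add: "\<And>f g. continuous_on UNIV f \<Longrightarrow> continuous_on UNIV g \<Longrightarrow> \<Lambda> (\<lambda>x. f x + g x) = \<Lambda> f + \<Lambda> g"
    and scale: "\<And>f c. continuous_on UNIV f \<Longrightarrow> \<Lambda> (\<lambda>x. c * f x) = c * \<Lambda> f"
    and nonneg: "\<And>f. continuous_on UNIV f \<Longrightarrow> (\<And>x. 0 \<le> f x) \<Longrightarrow> 0 \<le> \<Lambda> f"
    and unit: "\<Lambda> (\<lambda>_. 1) = 1"
begin

lemma const: "\<Lambda> (\<lambda>_. c) = c"
  using scale[of "\<lambda>_. 1" c] unit by simp

lemma mono:
  assumes "continuous_on UNIV f" "continuous_on UNIV g" "\<And>x. f x \<le> g x"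
  shows "\<Lambda> f \<le> \<Lambda> g"
proof -
  have "0 \<le> \<Lambda> (\<lambda>x. g x + (-1) * f x)"
    by (rule nonneg) (use assms in \<open>auto intro!: continuous_intros\<close>)
  also have "\<dots> = \<Lambda> g + \<Lambda> (\<lambda>x. (-1) * f x)"
    by (rule add) (use assms in \<open>auto intro!: continuous_intros\<close>)
  also have "\<dots> = \<Lambda> g - \<Lambda> f"
    using scale[OF assms(1), of "-1"] by simp
  finally show ?thesis by simp
qed

lemma sum:
  assumes "finite I" "\<And>i. i \<in> I \<Longrightarrow> continuous_on UNIV (f i)"
  shows "\<Lambda> (\<lambda>x. \<Sum>i\<in>I. f i x) = (\<Sum>i\<in>I. \<Lambda> (f i))"
  using assms by (induction I) (auto simp: const add continuous_on_sum)

text \<open>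
  Lowering \<open>f\<close> by \<open>e\<close> costs at most \<open>e\<close> and makes it vanish off the closed, hence compact, set where
  \<open>f \<ge> e\<close>. This is how functions that merely vanish off an open set get a compact support inside it.
\<close>
lemma truncate:
  assumes "continuous_on UNIV f"
  shows "\<Lambda> f \<le> \<Lambda> (\<lambda>x. max 0 (f x - e)) + e"
proof -
  have "\<Lambda> f \<le> \<Lambda> (\<lambda>x. max 0 (f x - e) + e)"
    by (rule mono) (use assms in \<open>auto intro!: continuous_intros\<close>)
  also have "\<dots> = \<Lambda> (\<lambda>x. max 0 (f x - e)) + e"
    using add[of "\<lambda>x. max 0 (f x - e)" "\<lambda>_. e"] assms by (simp add: const continuous_intros)
  finally show ?thesis .
qed

definition subordinate :: "'a set \<Rightarrow> ('a \<Rightarrow> real) set" where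
  "subordinate U = {f. continuous_on UNIV f \<and> (\<forall>x. 0 \<le> f x \<and> f x \<le> 1) \<and> (\<forall>x. x \<notin> U \<longrightarrow> f x = 0)}"

text \<open>
  The supremum runs over all continuous functions below the indicator of \<open>U\<close>, so it is the value that
  every measure representing \<open>\<Lambda>\<close> must take on an open set \<open>U\<close>.
\<close>
definition content :: "'a set \<Rightarrow> ennreal" where
  "content U = (SUP f\<in>subordinate U. ennreal (\<Lambda> f))"

definition outer :: "'a set \<Rightarrow> ennreal" where
  "outer A = (INF U\<in>{U. open U \<and> A \<subseteq> U}. content U)"

lemma zero_subordinate: "(\<lambda>_. 0) \<in> subordinate U"
  by (auto simp: subordinate_def)

lemma subordinate_nonneg: "f \<in> subordinate U \<Longrightarrow> 0 \<le> \<Lambda> f"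
  by (auto simp: subordinate_def intro: nonneg)

lemma le_content: "f \<in> subordinate U \<Longrightarrow> ennreal (\<Lambda> f) \<le> content U"
  unfolding content_def by (rule SUP_upper)

lemma content_mono: "U \<subseteq> V \<Longrightarrow> content U \<le> content V"
  unfolding content_def by (rule SUP_subset_mono) (auto simp: subordinate_def)

lemma content_empty: "content {} = 0"
proof -
  have "f = (\<lambda>_. 0)" if "f \<in> subordinate {}" for f
    using that by (auto simp: subordinate_def)
  then have "subordinate {} = {\<lambda>_. 0}"
    using zero_subordinate by blast
  then show ?thesis by (simp add: content_def const)
qed

lemma content_UNIV: "content UNIV = 1"
proof (rule antisym)
  show "content UNIV \<le> 1"
    unfolding content_def
  proof (rule SUP_least)
    fix f assume "f \<in> subordinate UNIV"
    then have "\<Lambda> f \<le> \<Lambda> (\<lambda>_. 1)"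
      by (intro mono) (auto simp: subordinate_def)
    then show "ennreal (\<Lambda> f) \<le> 1" by (simp add: unit)
  qed
  show "1 \<le> content UNIV"
    using le_content[of "\<lambda>_. 1" UNIV] by (simp add: unit subordinate_def)
qed

lemma outer_le_content: "open U \<Longrightarrow> A \<subseteq> U \<Longrightarrow> outer A \<le> content U"
  unfolding outer_def by (rule INF_lower) auto

lemma outer_open: "open U \<Longrightarrow> outer U = content U"
  by (rule antisym) (simp add: outer_le_content, auto simp: outer_def intro!: INF_greatest content_mono)

lemma outer_mono: "A \<subseteq> B \<Longrightarrow> outer A \<le> outer B"
  unfolding outer_def by (rule INF_superset_mono) auto

text \<open>
  After a truncation, \<open>f\<close> is supported in a compact set that finitely many of the sets \<open>U i\<close> cover.
  A partition of unity for this cover splits \<open>f\<close> into summands subordinate to single sets \<open>U i\<close>.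
\<close>
lemma content_countably_subadditive:
  fixes U :: "nat \<Rightarrow> 'a set"
  assumes U: "\<And>i. open (U i)"
  shows "content (\<Union>i. U i) \<le> (\<Sum>i. content (U i))"
  unfolding content_def[of "\<Union>i. U i"]
proof (rule SUP_least, rule ennreal_le_epsilon)
  fix f and e :: real
  assume f: "f \<in> subordinate (\<Union>i. U i)" and e: "0 < e"
  have cf: "continuous_on UNIV f" and f1: "\<And>x. f x \<le> 1" and f0: "\<And>x. f x \<noteq> 0 \<Longrightarrow> x \<in> (\<Union>i. U i)"
    using f by (auto simp: subordinate_def)
  define K where "K = {x. e \<le> f x}"
  have "closed K"
    unfolding K_def by (intro closed_Collect_le continuous_intros cf)
  then have K: "compact K"
    using compact_UNIV closed_Int_compact[of K UNIV] by simp
  moreover have "K \<subseteq> (\<Union>i. U i)"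
    using f0 e by (force simp: K_def)
  ultimately obtain I where I: "finite I" "K \<subseteq> (\<Union>i\<in>I. U i)"
    using U by (metis compactE_image)
  obtain g :: "nat \<Rightarrow> 'a \<Rightarrow> real" where cg: "\<And>i. continuous_on UNIV (g i)"
    and g0: "\<And>i x. 0 \<le> g i x" and g: "\<And>i x. 0 < g i x \<longleftrightarrow> x \<in> U i"
    using open_bump_function[OF U] by metis
  define G where "G x = (\<Sum>i\<in>I. g i x)" for x
  have cG: "continuous_on UNIV G"
    unfolding G_def by (intro continuous_intros cg)
  have Gpos: "0 < G x" if x: "x \<in> K" for x
  proof -
    obtain i where "i \<in> I" "0 < g i x" using I x g by blast
    then show ?thesis
      unfolding G_def using I(1) g0 by (meson sum_pos2)
  qed
  obtain d where d: "0 < d" "\<And>x. x \<in> K \<Longrightarrow> d \<le> G x"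
  proof (cases "K = {}")
    case False
    obtain y where "y \<in> K" "\<And>x. x \<in> K \<Longrightarrow> G y \<le> G x"
      using continuous_attains_inf[OF K False, of G] cG continuous_on_subset by blast
    then show ?thesis using Gpos that by blast
  qed (use that[of 1] in auto)
  define f' where "f' x = max 0 (f x - e)" for x
  have cf': "continuous_on UNIV f'"
    unfolding f'_def by (intro continuous_intros cf)
  \<comment> \<open>Dividing by \<open>max d (G x)\<close> instead of \<open>G x\<close> keeps the quotient continuous where \<open>G\<close> vanishes;
    on \<open>K\<close>, outside of which \<open>f'\<close> is zero, both divisors agree.\<close>
  define h where "h i x = f' x * (g i x / max d (G x))" for i x
  have ch: "continuous_on UNIV (h i)" for i
    unfolding h_def using d(1) by (intro continuous_intros cg cG cf') (auto simp: max_def)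
  have f'h: "f' x = (\<Sum>i\<in>I. h i x)" for x
  proof (cases "x \<in> K")
    case True
    then show ?thesis
      using d Gpos[OF True]
      by (simp add: h_def max_def flip: sum_distrib_left sum_divide_distrib G_def)
  next
    case False
    then show ?thesis by (simp add: h_def f'_def K_def)
  qed
  have h_sub: "h i \<in> subordinate (U i)" if i: "i \<in> I" for i
  proof -
    have "h i x \<le> 1" for x
    proof -
      have "g i x \<le> max d (G x)"
        unfolding G_def using member_le_sum[of i I "\<lambda>i. g i x"] I(1) i g0 by fastforce
      then have "g i x / max d (G x) \<le> 1" using d(1) by (simp add: max_def)
      moreover have "f' x \<le> 1" "0 \<le> f' x" using f1[of x] e by (auto simp: f'_def)
      ultimately show ?thesis
        unfolding h_def using mult_mono[of "f' x" 1 "g i x / max d (G x)" 1] g0[of i x] d(1) by auto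
    qed
    moreover have "0 \<le> h i x" for x
      using d(1) g0[of i x] by (auto simp: h_def f'_def)
    moreover have "h i x = 0" if "x \<notin> U i" for x
      using that g[of i x] g0[of i x] by (auto simp: h_def)
    ultimately show ?thesis by (simp add: subordinate_def ch)
  qed
  have "\<Lambda> f \<le> \<Lambda> f' + e"
    unfolding f'_def using truncate[OF cf] .
  also have "\<Lambda> f' = (\<Sum>i\<in>I. \<Lambda> (h i))"
    using sum[OF I(1), of h] ch by (simp flip: f'h)
  finally have "ennreal (\<Lambda> f) \<le> ennreal ((\<Sum>i\<in>I. \<Lambda> (h i)) + e)"
    by (rule ennreal_leI)
  also have "\<dots> = (\<Sum>i\<in>I. ennreal (\<Lambda> (h i))) + e"
    using subordinate_nonneg[OF h_sub] e by (simp add: ennreal_plus sum_nonneg)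
  also have "\<dots> \<le> (\<Sum>i\<in>I. content (U i)) + e"
    using h_sub by (intro add_mono sum_mono le_content) auto
  also have "\<dots> \<le> (\<Sum>i. content (U i)) + e"
    using I(1) by (intro add_mono sum_le_suminf) auto
  finally show "ennreal (\<Lambda> f) \<le> (\<Sum>i. content (U i)) + ennreal e" .
qed

lemma outer_measure_space_outer: "outer_measure_space (Pow UNIV) outer"
proof -
  have "outer (\<Union>i. A i) \<le> (\<Sum>i. outer (A i))" for A :: "nat \<Rightarrow> 'a set"
  proof (rule ennreal_le_epsilon)
    fix e :: real
    assume fin: "(\<Sum>i. outer (A i)) < top" and e: "0 < e"
    have "\<exists>U. open U \<and> A n \<subseteq> U \<and> content U \<le> outer (A n) + e * (1/2) ^ Suc n" for n
    proof -
      have "outer (A n) < top" using fin by (auto simp: less_top dest!: ennreal_suminf_lessD)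
      then have "outer (A n) < outer (A n) + e * (1/2) ^ Suc n"
        using e by (auto simp: ennreal_zero_less_mult_iff)
      then show ?thesis
        unfolding outer_def[of "A n"] INF_less_iff by (auto simp: less_imp_le)
    qed
    then obtain U where U: "\<And>n. open (U n)" "\<And>n. A n \<subseteq> U n"
      and cU: "\<And>n. content (U n) \<le> outer (A n) + e * (1/2) ^ Suc n"
      by metis
    have "outer (\<Union>i. A i) \<le> content (\<Union>i. U i)"
      using U by (intro outer_le_content) auto
    also have "\<dots> \<le> (\<Sum>i. content (U i))"
      using U by (intro content_countably_subadditive)
    also have "\<dots> \<le> (\<Sum>i. outer (A i) + e * (1/2) ^ Suc i)"
      using cU by (intro suminf_le) auto
    also have "\<dots> = (\<Sum>i. outer (A i) + ennreal e * ennreal ((1/2) ^ Suc i))"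
      using e by (subst ennreal_mult) auto
    also have "\<dots> = (\<Sum>i. outer (A i)) + (\<Sum>i. ennreal e * ennreal ((1/2) ^ Suc i))"
      by (rule suminf_add[symmetric]) auto
    also have "(\<Sum>i. ennreal e * ennreal ((1/2) ^ Suc i)) = e"
      by (subst ennreal_suminf_cmult, subst suminf_ennreal_eq[OF zero_le_power power_half_series]) auto
    finally show "outer (\<Union>i. A i) \<le> (\<Sum>i. outer (A i)) + ennreal e" .
  qed
  then show ?thesis
    by (auto simp: outer_measure_space_def positive_def increasing_def countably_subadditive_def
        outer_open content_empty outer_mono)
qed

text \<open>
  The half of Caratheodory's criterion that is not subadditivity. A function \<open>f\<close> subordinate to
  \<open>V \<inter> U\<close> is truncated, which leaves room next to it: the open set \<open>W\<close> where \<open>f < e\<close> still contains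
  \<open>V - U\<close>, and the truncation of \<open>f\<close> plus any function subordinate to \<open>W\<close> is subordinate to \<open>V\<close>.
\<close>
lemma content_ge_split:
  assumes U: "open U" and V: "open V"
  shows "content (V \<inter> U) + outer (V - U) \<le> content V"
proof -
  have "ennreal (\<Lambda> f) + outer (V - U) \<le> content V" if f: "f \<in> subordinate (V \<inter> U)" for f
  proof (rule ennreal_le_epsilon)
    fix e :: real assume e: "0 < e"
    have cf: "continuous_on UNIV f" using f by (simp add: subordinate_def)
    define f' where "f' x = max 0 (f x - e)" for x
    have cf': "continuous_on UNIV f'"
      unfolding f'_def by (intro continuous_intros cf)
    have f'0: "0 \<le> \<Lambda> f'" by (rule nonneg[OF cf']) (simp add: f'_def)
    define W where "W = V \<inter> {x. f x < e}"
    have W: "open W"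
      unfolding W_def by (intro open_Int V open_Collect_less cf continuous_intros)
    have "outer (V - U) \<le> content W"
      using f e by (intro outer_le_content[OF W]) (auto simp: W_def subordinate_def)
    moreover have "ennreal (\<Lambda> f) \<le> ennreal (\<Lambda> f') + e"
      using truncate[OF cf, of e] f'0 e by (simp add: f'_def[symmetric] flip: ennreal_plus)
    moreover have "content W + ennreal (\<Lambda> f') \<le> content V"
    proof -
      have "ennreal (\<Lambda> g) + ennreal (\<Lambda> f') \<le> content V" if g: "g \<in> subordinate W" for g
      proof -
        have cg: "continuous_on UNIV g" and g0: "\<And>x. 0 \<le> g x" "\<And>x. g x \<le> 1"
          and gW: "\<And>x. x \<notin> W \<Longrightarrow> g x = 0"
          using g by (auto simp: subordinate_def)
        have "(\<lambda>x. g x + f' x) \<in> subordinate V"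
        proof -
          have "g x + f' x \<le> 1" for x
          proof (cases "x \<in> W")
            case True
            then show ?thesis using g0(2)[of x] by (simp add: W_def f'_def)
          next
            case False
            moreover have "f x \<le> 1" using f by (simp add: subordinate_def)
            ultimately show ?thesis using gW[of x] e by (simp add: f'_def)
          qed
          moreover have "g x + f' x = 0" if "x \<notin> V" for x
            using that f e gW by (auto simp: W_def f'_def subordinate_def)
          ultimately show ?thesis
            using cg cf' g0(1) by (auto simp: subordinate_def f'_def intro!: continuous_intros)
        qed
        then have "ennreal (\<Lambda> g + \<Lambda> f') \<le> content V"
          using le_content add[OF cg cf'] by metis
        then show ?thesis
          using f'0 subordinate_nonneg[OF g] by simp
      qed
      moreover have "content W + ennreal (\<Lambda> f') = (SUP g\<in>subordinate W. ennreal (\<Lambda> g) + ennreal (\<Lambda> f'))"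
        unfolding content_def using zero_subordinate by (subst ennreal_SUP_add_left) auto
      ultimately show ?thesis by (auto intro: SUP_least)
    qed
    ultimately have "ennreal (\<Lambda> f) + outer (V - U) \<le> (ennreal (\<Lambda> f') + e) + content W"
      by (intro add_mono)
    also have "\<dots> = (content W + ennreal (\<Lambda> f')) + e" by (simp add: ac_simps)
    also have "\<dots> \<le> content V + e"
      by (intro add_mono) (fact, simp)
    finally show "ennreal (\<Lambda> f) + outer (V - U) \<le> content V + ennreal e" .
  qed
  moreover have "content (V \<inter> U) + outer (V - U) = (SUP f\<in>subordinate (V \<inter> U). ennreal (\<Lambda> f) + outer (V - U))"
    unfolding content_def using zero_subordinate by (subst ennreal_SUP_add_left) auto
  ultimately show ?thesis by (auto intro: SUP_least)
qed

lemma open_in_lambda_system: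
  assumes U: "open U"
  shows "U \<in> lambda_system UNIV (Pow UNIV) outer"
proof -
  interpret P: sigma_algebra UNIV "Pow (UNIV :: 'a set)" by (rule sigma_algebra_Pow)
  have "outer (A \<inter> U) + outer (A - U) = outer A" for A
  proof (rule antisym)
    show "outer (A \<inter> U) + outer (A - U) \<le> outer A"
      unfolding outer_def[of A]
    proof (rule INF_greatest)
      fix V assume "V \<in> {V. open V \<and> A \<subseteq> V}"
      then have V: "open V" "A \<subseteq> V" by auto
      have "outer (A \<inter> U) + outer (A - U) \<le> content (V \<inter> U) + outer (V - U)"
        using V U by (intro add_mono outer_le_content outer_mono) auto
      also have "\<dots> \<le> content V" by (rule content_ge_split[OF U V(1)])
      finally show "outer (A \<inter> U) + outer (A - U) \<le> content V" .
    qed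
    have "subadditive (Pow UNIV) outer"
      using outer_measure_space_outer P.countably_subadditive_subadditive
      by (auto simp: outer_measure_space_def)
    from subadditiveD[OF this, of "A \<inter> U" "A - U"]
    show "outer A \<le> outer (A \<inter> U) + outer (A - U)"
      by (simp add: Int_Diff_disjoint Un_Diff_Int Int_Diff_Un)
  qed
  then show ?thesis unfolding P.lambda_system_eq by simp
qed

definition representing_measure :: "'a measure" where
  "representing_measure = measure_of UNIV (sets borel) outer"

lemma sets_representing_measure: "sets representing_measure = sets borel"
  using sets.sigma_sets_eq[of "borel :: 'a measure"]
  by (simp add: representing_measure_def sets_measure_of_conv)

lemma emeasure_representing_measure:
  assumes "B \<in> sets borel"
  shows "emeasure representing_measure B = outer B"
proof -
  interpret P: sigma_algebra UNIV "Pow (UNIV :: 'a set)" by (rule sigma_algebra_Pow)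
  let ?L = "lambda_system UNIV (Pow UNIV) outer"
  have ms: "measure_space UNIV ?L outer"
    by (rule P.caratheodory_lemma[OF outer_measure_space_outer])
  then interpret L: sigma_algebra UNIV ?L by (simp add: measure_space_def)
  have sub: "sets borel \<subseteq> ?L"
    unfolding borel_def using open_in_lambda_system L.sigma_sets_subset[of "Collect open"]
    by auto
  have "countably_additive (sets borel) outer"
    using ms sub by (auto simp: measure_space_def countably_additive_def subset_eq)
  moreover have "positive (sets borel) outer"
    using outer_open[of "{}"] by (simp add: positive_def content_empty)
  ultimately show ?thesis
    unfolding representing_measure_def using assms sets.sigma_algebra_axioms[of "borel :: 'a measure"]
    by (intro emeasure_measure_of_sigma) auto
qed

lemma prob_space_representing_measure: "prob_space representing_measure"
proof
  have "space representing_measure = UNIV"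
    using sets_eq_imp_space_eq[OF sets_representing_measure] by simp
  then show "emeasure representing_measure (space representing_measure) = 1"
    by (simp add: emeasure_representing_measure outer_open content_UNIV)
qed

text \<open>
  Cutting \<open>N * f\<close> into \<open>N\<close> unit layers, each layer is a function between 0 and 1 that lives on the
  superlevel set \<open>{x. k < N * f x}\<close>, so its value under the functional is at most the measure of this set. The sum of
  these measures exceeds the integral of \<open>N * f\<close> by at most 1, an error that vanishes after division
  by \<open>N\<close>.
\<close>
lemma le_integral_unit_interval:
  assumes cf: "continuous_on UNIV f" and f: "\<And>x. 0 \<le> f x" "\<And>x. f x \<le> 1"
  shows "\<Lambda> f \<le> (\<integral>x. f x \<partial>representing_measure)"
proof -
  let ?\<nu> = representing_measure
  interpret prob_space ?\<nu> by (rule prob_space_representing_measure)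
  note [measurable_cong] = sets_representing_measure
  have [measurable]: "f \<in> borel_measurable borel"
    using cf by (rule borel_measurable_continuous_onI)
  have int_f: "integrable ?\<nu> f"
    by (rule integrable_const_bound[of _ 1]) (use f in \<open>auto simp: abs_of_nonneg\<close>)
  have N: "real N * \<Lambda> f \<le> real N * (\<integral>x. f x \<partial>?\<nu>) + 1" for N
  proof -
    define h where "h k x = min 1 (max 0 (real N * f x - real k))" for k x
    have ch: "continuous_on UNIV (h k)" for k
      unfolding h_def by (intro continuous_intros cf)
    have le: "\<Lambda> (h k) \<le> measure ?\<nu> {x. real k < real N * f x}" for k
    proof -
      have op: "open {x. real k < real N * f x}"
        by (intro open_Collect_less continuous_intros cf)
      have "ennreal (\<Lambda> (h k)) \<le> content {x. real k < real N * f x}"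
        by (rule le_content) (auto simp: subordinate_def ch, auto simp: h_def)
      also have "\<dots> = emeasure ?\<nu> {x. real k < real N * f x}"
        using op by (simp add: emeasure_representing_measure outer_open)
      finally show ?thesis by (simp add: emeasure_eq_measure)
    qed
    have "real N * f x = (\<Sum>k<N. h k x)" for x
      unfolding h_def using f[of x] by (subst sum_unit_layers) (auto simp: min_absorb2 mult_left_le)
    then have "real N * \<Lambda> f = (\<Sum>k<N. \<Lambda> (h k))"
      using scale[OF cf, of "real N"] sum[of "{..<N}" h] ch by simp
    also have "\<dots> \<le> (\<Sum>k<N. measure ?\<nu> {x. real k < real N * f x})"
      by (intro sum_mono le)
    also have "\<dots> = (\<Sum>k<N. \<integral>x. indicator {x. real k < real N * f x} x \<partial>?\<nu>)"
      by (simp add: sets_eq_imp_space_eq[OF sets_representing_measure])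
    also have "\<dots> = (\<integral>x. (\<Sum>k<N. indicator {x. real k < real N * f x} x) \<partial>?\<nu>)"
      by (subst Bochner_Integration.integral_sum)
        (auto intro!: integrable_real_indicator simp: emeasure_eq_measure)
    also have "\<dots> \<le> (\<integral>x. real N * f x + 1 \<partial>?\<nu>)"
    proof (rule integral_mono)
      show "(\<Sum>k<N. indicator {x. real k < real N * f x} x) \<le> real N * f x + 1" for x
        using sum_of_bool_layers_le[of "real N * f x" N] f(1)[of x] by (simp add: indicator_def)
    qed (auto intro!: integrable_real_indicator Bochner_Integration.integrable_sum int_f
          simp: emeasure_eq_measure)
    also have "\<dots> = real N * (\<integral>x. f x \<partial>?\<nu>) + 1"
      using int_f by (simp add: prob_space)
    finally show ?thesis .
  qed
  show ?thesis
  proof (rule field_le_epsilon)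
    fix e :: real assume "0 < e"
    then obtain N :: nat where N1: "1 / e < real N" using reals_Archimedean2 by blast
    moreover have "0 < 1 / e" using \<open>0 < e\<close> by simp
    ultimately have Npos: "0 < real N" by linarith
    have "real N * \<Lambda> f \<le> real N * (\<integral>x. f x \<partial>?\<nu>) + real N * e"
      using N[of N] N1 \<open>0 < e\<close> by (simp add: field_simps)
    then have "real N * \<Lambda> f \<le> real N * ((\<integral>x. f x \<partial>?\<nu>) + e)"
      by (simp add: distrib_left)
    then show "\<Lambda> f \<le> (\<integral>x. f x \<partial>?\<nu>) + e"
      using Npos by (simp only: mult_le_cancel_left_pos)
  qed
qed

text \<open>
  The inequality for functions with values in the unit interval extends to all continuous functions
  by an affine change of variables; applied to \<open>f\<close> and to \<open>-f\<close> it becomes an equality.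
\<close>
theorem riesz_representation:
  assumes cf: "continuous_on UNIV f"
  shows "\<Lambda> f = (\<integral>x. f x \<partial>representing_measure)"
proof -
  let ?\<nu> = representing_measure
  interpret prob_space ?\<nu> by (rule prob_space_representing_measure)
  note [measurable_cong] = sets_representing_measure
  have le: "\<Lambda> f \<le> (\<integral>x. f x \<partial>?\<nu>)" and int: "integrable ?\<nu> f"
    if cf: "continuous_on UNIV f" for f
  proof -
    have [measurable]: "f \<in> borel_measurable borel"
      using cf by (rule borel_measurable_continuous_onI)
    obtain B where B: "0 < B" "\<And>x. \<bar>f x\<bar> \<le> B"
      using compact_UNIV_bounded_range[OF compact_UNIV cf] by (auto simp: bounded_pos)
    show int: "integrable ?\<nu> f"
      by (rule integrable_const_bound[of _ B]) (use B in auto)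
    define g where "g x = (1 / (2 * B)) * (f x + B)" for x
    have "\<Lambda> g = (1 / (2 * B)) * (\<Lambda> f + B)"
      unfolding g_def using cf by (simp only: scale add const continuous_intros)
    moreover have "(\<integral>x. g x \<partial>?\<nu>) = (1 / (2 * B)) * ((\<integral>x. f x \<partial>?\<nu>) + B)"
      unfolding g_def using int by (simp add: prob_space)
    moreover have "\<Lambda> g \<le> (\<integral>x. g x \<partial>?\<nu>)"
    proof (rule le_integral_unit_interval)
      show "continuous_on UNIV g" unfolding g_def by (intro continuous_intros cf)
      show "0 \<le> g x" "g x \<le> 1" for x
        using B(2)[of x] B(1) by (auto simp: g_def field_simps abs_le_iff)
    qed
    ultimately have "(1 / (2 * B)) * (\<Lambda> f + B) \<le> (1 / (2 * B)) * ((\<integral>x. f x \<partial>?\<nu>) + B)" by simp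
    then show "\<Lambda> f \<le> (\<integral>x. f x \<partial>?\<nu>)"
      using B(1) by (simp add: field_simps)
  qed
  have "continuous_on UNIV (\<lambda>x. - 1 * f x)"
    by (intro continuous_intros cf)
  from le[OF this] have "- 1 * \<Lambda> f \<le> - (\<integral>x. f x \<partial>?\<nu>)"
    by (subst scale[OF cf, symmetric]) simp
  with le[OF cf] show ?thesis by simp
qed

end

section \<open>The kernel of a transfer operator\<close>

lemma space_borel_prob_measure: "\<nu> \<in> borel_prob_measures \<Longrightarrow> space \<nu> = UNIV"
  using sets_eq_imp_space_eq[of \<nu> borel] by (auto simp: borel_prob_measures_def)

lemma apply_Bcontfun_of_real:
  fixes f :: "'a::topological_space \<Rightarrow> real"
  assumes "continuous_on UNIV f" "bounded (range f)"
  shows "apply_bcontfun (Bcontfun (\<lambda>x. complex_of_real (f x))) x = complex_of_real (f x)"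
proof -
  have "(\<lambda>x. complex_of_real (f x)) \<in> bcontfun"
    using assms by (auto simp: bcontfun_def bounded_iff intro!: continuous_intros)
  then show ?thesis by (simp add: Bcontfun_inverse)
qed

lemma integrable_bounded_borel:
  fixes f :: "'a::topological_space \<Rightarrow> 'b::{banach, second_countable_topology}"
  assumes "\<nu> \<in> borel_prob_measures" "f \<in> borel_measurable borel" "bounded (range f)"
  shows "integrable \<nu> f"
proof -
  interpret prob_space \<nu> using assms by (simp add: borel_prob_measures_def)
  obtain B where "\<And>x. norm (f x) \<le> B" using assms(3) by (auto simp: bounded_iff)
  moreover have "f \<in> borel_measurable \<nu>"
    using assms measurable_cong_sets[of \<nu> borel] by (auto simp: borel_prob_measures_def)
  ultimately show ?thesis by (intro integrable_const_bound[of _ B]) auto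
qed

lemma integrable_bcontfun:
  fixes f :: "'a::topological_space \<Rightarrow>\<^sub>C complex"
  assumes "\<nu> \<in> borel_prob_measures"
  shows "integrable \<nu> (apply_bcontfun f)"
  by (intro integrable_bounded_borel assms bounded_apply_bcontfun borel_measurable_continuous_onI
      continuous_on_apply_bcontfun)

text \<open>
  The indicator of an open set is an increasing limit of continuous functions that do not depend on the
  measure. Hence the measures of open sets depend on the integrals of continuous functions in a
  countable way, which serves twice: for the uniqueness of the representing measure and for the
  measurability of the transfer kernel.
\<close>
lemma open_measure_limit:
  fixes U :: "'a::metric_space set"
  assumes "open U"
  obtains G :: "nat \<Rightarrow> 'a \<Rightarrow>\<^sub>C complex"
  where "\<And>\<nu>. \<nu> \<in> borel_prob_measures \<Longrightarrow> (\<lambda>n. Re (\<integral>x. apply_bcontfun (G n) x \<partial>\<nu>)) \<longlonglongrightarrow> measure \<nu> U"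
proof -
  obtain g :: "'a \<Rightarrow> real" where cg: "continuous_on UNIV g" and g0: "\<And>x. 0 \<le> g x"
    and g: "\<And>x. 0 < g x \<longleftrightarrow> x \<in> U"
    using open_bump_function[OF assms] by metis
  define h where "h n x = min 1 (real n * g x)" for n x
  have ch: "continuous_on UNIV (h n)" for n
    unfolding h_def by (intro continuous_intros cg)
  have h: "0 \<le> h n x" "h n x \<le> 1" for n x using g0[of x] by (auto simp: h_def)
  then have bh: "bounded (range (h n))" for n
    by (auto simp: bounded_iff intro!: exI[of _ 1])
  have lim: "(\<lambda>n. h n x) \<longlonglongrightarrow> indicator U x" for x
  proof (cases "x \<in> U")
    case True
    then have "0 < g x" using g by simp
    obtain N :: nat where N: "1 / g x < real N" using reals_Archimedean2 by blast
    have "h n x = 1" if "N \<le> n" for n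
    proof -
      have "1 / g x \<le> real n" using N that by linarith
      then show ?thesis using \<open>0 < g x\<close> by (simp add: h_def field_simps)
    qed
    then have "\<forall>\<^sub>F n in sequentially. h n x = indicator U x"
      using True by (auto simp: eventually_sequentially)
    then show ?thesis by (rule tendsto_eventually)
  next
    case False
    then have "g x = 0" using g[of x] g0[of x] by simp
    then show ?thesis using False by (simp add: h_def)
  qed
  show ?thesis
  proof (rule that[of "\<lambda>n. Bcontfun (\<lambda>x. complex_of_real (h n x))"])
    fix \<nu> :: "'a measure" assume \<nu>: "\<nu> \<in> borel_prob_measures"
    interpret prob_space \<nu> using \<nu> by (simp add: borel_prob_measures_def)
    have [measurable_cong]: "sets \<nu> = sets borel" using \<nu> by (simp add: borel_prob_measures_def)
    have [measurable]: "h n \<in> borel_measurable borel" for n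
      using ch by (rule borel_measurable_continuous_onI)
    have [measurable]: "U \<in> sets borel" using assms by simp
    have "(\<lambda>n. \<integral>x. h n x \<partial>\<nu>) \<longlonglongrightarrow> (\<integral>x. indicator U x \<partial>\<nu>)"
      by (rule integral_dominated_convergence[where w = "\<lambda>_. 1"]) (use lim h in auto)
    then show "(\<lambda>n. Re (\<integral>x. apply_bcontfun (Bcontfun (\<lambda>x. complex_of_real (h n x))) x \<partial>\<nu>))
        \<longlonglongrightarrow> measure \<nu> U"
      by (simp add: apply_Bcontfun_of_real[OF ch bh] space_borel_prob_measure[OF \<nu>])
  qed
qed

lemma borel_prob_measures_eqI:
  fixes \<nu>\<^sub>1 \<nu>\<^sub>2 :: "'a::metric_space measure"
  assumes \<nu>: "\<nu>\<^sub>1 \<in> borel_prob_measures" "\<nu>\<^sub>2 \<in> borel_prob_measures"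
    and eq: "\<And>f. (\<integral>x. apply_bcontfun f x \<partial>\<nu>\<^sub>1) = (\<integral>x. apply_bcontfun (f :: 'a \<Rightarrow>\<^sub>C complex) x \<partial>\<nu>\<^sub>2)"
  shows "\<nu>\<^sub>1 = \<nu>\<^sub>2"
proof -
  interpret N1: prob_space \<nu>\<^sub>1 using \<nu> by (simp add: borel_prob_measures_def)
  interpret N2: prob_space \<nu>\<^sub>2 using \<nu> by (simp add: borel_prob_measures_def)
  show ?thesis
  proof (rule measure_eqI_generator_eq[where E = "Collect open" and \<Omega> = UNIV and A = "\<lambda>_. UNIV"])
    show "Int_stable (Collect open :: 'a set set)" by (auto simp: Int_stable_def)
    show "emeasure \<nu>\<^sub>1 U = emeasure \<nu>\<^sub>2 U" if "U \<in> Collect open" for U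
    proof -
      obtain G :: "nat \<Rightarrow> 'a \<Rightarrow>\<^sub>C complex" where
        "\<And>\<nu>. \<nu> \<in> borel_prob_measures \<Longrightarrow> (\<lambda>n. Re (\<integral>x. apply_bcontfun (G n) x \<partial>\<nu>)) \<longlonglongrightarrow> measure \<nu> U"
        using open_measure_limit \<open>U \<in> Collect open\<close> by blast
      from this[OF \<nu>(1)] this[OF \<nu>(2)] have "measure \<nu>\<^sub>1 U = measure \<nu>\<^sub>2 U"
        unfolding eq by (rule LIMSEQ_unique)
      then show ?thesis by (simp add: N1.emeasure_eq_measure N2.emeasure_eq_measure)
    qed
  qed (use \<nu> in \<open>auto simp: borel_prob_measures_def borel_def\<close>)
qed

text \<open>
  Positivity forces a functional on complex functions to be real on real ones, because every real
  continuous function becomes non-negative after a constant is added. The real theorem then applies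
  to real and imaginary parts separately.
\<close>
lemma riesz_markov_complex:
  fixes \<Phi> :: "('a::metric_space \<Rightarrow>\<^sub>C complex) \<Rightarrow> complex"
  assumes compact: "compact (UNIV :: 'a set)"
    and add: "\<And>f g. \<Phi> (f + g) = \<Phi> f + \<Phi> g"
    and scale: "\<And>c f. \<Phi> (cscale c f) = c * \<Phi> f"
    and nonneg: "\<And>f. range (apply_bcontfun f) \<subseteq> \<real>\<^sub>\<ge>\<^sub>0 \<Longrightarrow> \<Phi> f \<in> \<real>\<^sub>\<ge>\<^sub>0"
    and unit: "\<Phi> (const_bcontfun 1) = 1"
  shows "\<exists>!\<nu>. \<nu> \<in> borel_prob_measures \<and> (\<forall>f. \<Phi> f = (\<integral>x. apply_bcontfun f x \<partial>\<nu>))"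
proof -
  define emb :: "('a \<Rightarrow> real) \<Rightarrow> 'a \<Rightarrow>\<^sub>C complex" where "emb f = Bcontfun (\<lambda>x. complex_of_real (f x))" for f
  have emb: "apply_bcontfun (emb f) x = complex_of_real (f x)" if "continuous_on UNIV f" for f x
    unfolding emb_def using apply_Bcontfun_of_real[OF that compact_UNIV_bounded_range[OF compact that]] .
  have emb_add: "\<Phi> (emb (\<lambda>x. f x + g x)) = \<Phi> (emb f) + \<Phi> (emb g)"
    if "continuous_on UNIV f" "continuous_on UNIV g" for f g
    unfolding add[symmetric] using that
    by (intro arg_cong[of _ _ \<Phi>] bcontfun_eqI) (simp add: emb continuous_on_add)
  have emb_scale: "\<Phi> (emb (\<lambda>x. c * f x)) = complex_of_real c * \<Phi> (emb f)"
    if "continuous_on UNIV f" for f c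
    unfolding scale[symmetric] using that
    by (intro arg_cong[of _ _ \<Phi>] bcontfun_eqI) (simp add: emb continuous_on_mult_left)
  have emb_one: "\<Phi> (emb (\<lambda>_. 1)) = 1"
    by (subst unit[symmetric], intro arg_cong[of _ _ \<Phi>] bcontfun_eqI) (simp add: emb)
  have emb_nonneg: "\<Phi> (emb f) \<in> \<real>\<^sub>\<ge>\<^sub>0" if "continuous_on UNIV f" "\<And>x. 0 \<le> f x" for f
    by (rule nonneg) (use that in \<open>auto simp: emb\<close>)
  have emb_real: "\<Phi> (emb f) = complex_of_real (Re (\<Phi> (emb f)))" if f: "continuous_on UNIV f" for f
  proof -
    obtain B where B: "\<And>x. \<bar>f x\<bar> \<le> B"
      using compact_UNIV_bounded_range[OF compact f] by (auto simp: bounded_iff)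
    have "0 \<le> f x + B" for x using B[of x] by linarith
    then have "\<Phi> (emb (\<lambda>x. f x + B * 1)) \<in> \<real>\<^sub>\<ge>\<^sub>0"
      using f by (intro emb_nonneg continuous_intros) auto
    moreover have "\<Phi> (emb (\<lambda>x. f x + B * 1)) = \<Phi> (emb f) + complex_of_real B"
      using f emb_scale[of "\<lambda>_. 1" B] emb_one by (subst emb_add) auto
    ultimately show ?thesis by (simp add: complex_nonneg_Reals_iff complex_eq_iff)
  qed
  interpret R: positive_unital_functional "\<lambda>f. Re (\<Phi> (emb f))"
    using emb_nonneg by unfold_locales
      (simp_all add: compact emb_add emb_scale emb_one complex_nonneg_Reals_iff)
  let ?\<nu> = R.representing_measure
  have \<nu>: "?\<nu> \<in> borel_prob_measures"
    using R.sets_representing_measure R.prob_space_representing_measure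
    by (simp add: borel_prob_measures_def)
  have rep: "\<Phi> f = (\<integral>x. apply_bcontfun f x \<partial>?\<nu>)" for f
  proof -
    have cre: "continuous_on UNIV (\<lambda>x. Re (apply_bcontfun f x))"
      and cim: "continuous_on UNIV (\<lambda>x. Im (apply_bcontfun f x))"
      by (intro continuous_intros continuous_on_apply_bcontfun)+
    have "\<Phi> f = \<Phi> (emb (\<lambda>x. Re (apply_bcontfun f x)) + cscale \<i> (emb (\<lambda>x. Im (apply_bcontfun f x))))"
      by (intro arg_cong[of _ _ \<Phi>] bcontfun_eqI) (simp add: emb[OF cre] emb[OF cim] complex_eq_iff)
    also have "\<dots> = \<Phi> (emb (\<lambda>x. Re (apply_bcontfun f x))) + \<i> * \<Phi> (emb (\<lambda>x. Im (apply_bcontfun f x)))"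
      by (simp only: add scale)
    also have "\<dots> = complex_of_real (\<integral>x. Re (apply_bcontfun f x) \<partial>?\<nu>)
        + \<i> * complex_of_real (\<integral>x. Im (apply_bcontfun f x) \<partial>?\<nu>)"
      using emb_real[OF cre] emb_real[OF cim] R.riesz_representation[OF cre] R.riesz_representation[OF cim]
      by simp
    also have "\<dots> = (\<integral>x. apply_bcontfun f x \<partial>?\<nu>)"
      using integrable_bcontfun[OF \<nu>, of f] by (simp add: complex_eq_iff)
    finally show ?thesis .
  qed
  show ?thesis
  proof (rule ex1I[of _ ?\<nu>])
    show "?\<nu> \<in> borel_prob_measures \<and> (\<forall>f. \<Phi> f = (\<integral>x. apply_bcontfun f x \<partial>?\<nu>))"
      using \<nu> rep by blast
    show "\<nu> = ?\<nu>" if "\<nu> \<in> borel_prob_measures \<and> (\<forall>f. \<Phi> f = (\<integral>x. apply_bcontfun f x \<partial>\<nu>))" for \<nu>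
      using that \<nu> rep by (intro borel_prob_measures_eqI) metis+
  qed
qed

context
  fixes L :: "('a::metric_space \<Rightarrow>\<^sub>C complex) \<Rightarrow> ('a \<Rightarrow>\<^sub>C complex)"
  assumes compact: "compact (UNIV :: 'a set)"
    and L: "transfer_operator L"
begin

lemma transfer_operator_add: "L (f + g) = L f + L g"
  and transfer_operator_cscale: "L (cscale c f) = cscale c (L f)"
  and transfer_operator_nonneg:
    "range (apply_bcontfun f) \<subseteq> \<real>\<^sub>\<ge>\<^sub>0 \<Longrightarrow> range (apply_bcontfun (L f)) \<subseteq> \<real>\<^sub>\<ge>\<^sub>0"
  and transfer_operator_one: "L (const_bcontfun 1) = const_bcontfun 1"
proof -
  have "Vector_Spaces.linear cscale cscale L" using L by (simp add: transfer_operator_def)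
  then interpret Vector_Spaces.linear cscale cscale L .
  show "L (f + g) = L f + L g" "L (cscale c f) = cscale c (L f)" by (rule add, rule scale)
qed (use L in \<open>auto simp: transfer_operator_def\<close>)

lemma transfer_kernel_unique_existence:
  "\<exists>!\<nu>. \<nu> \<in> borel_prob_measures \<and> (\<forall>f. apply_bcontfun (L f) x = (\<integral>y. apply_bcontfun f y \<partial>\<nu>))"
proof (rule riesz_markov_complex[OF compact])
  show "apply_bcontfun (L f) x \<in> \<real>\<^sub>\<ge>\<^sub>0" if "range (apply_bcontfun f) \<subseteq> \<real>\<^sub>\<ge>\<^sub>0" for f
    using transfer_operator_nonneg[OF that] by auto
qed (simp_all add: transfer_operator_add transfer_operator_cscale transfer_operator_one)

lemma transfer_kernel_prob: "transfer_kernel L x \<in> borel_prob_measures"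
  and transfer_kernel_integral:
    "apply_bcontfun (L f) x = (\<integral>y. apply_bcontfun f y \<partial>transfer_kernel L x)"
  using theI'[OF transfer_kernel_unique_existence[of x]] unfolding transfer_kernel_def by blast+

text \<open>
  The dual measure is the one that represents the functional \<open>f \<mapsto> \<integral> L f d\<mu>\<close>.
\<close>
lemma dual_transfer_operator_integral:
  assumes \<mu>: "\<mu> \<in> borel_prob_measures"
  shows "(\<integral>x. apply_bcontfun f x \<partial>dual_transfer_operator L \<mu>) = (\<integral>x. apply_bcontfun (L f) x \<partial>\<mu>)"
proof -
  interpret prob_space \<mu> using \<mu> by (simp add: borel_prob_measures_def)
  note int = integrable_bcontfun[OF \<mu>]
  have "\<exists>!\<nu>. \<nu> \<in> borel_prob_measures \<and>
      (\<forall>f. (\<integral>x. apply_bcontfun (L f) x \<partial>\<mu>) = (\<integral>x. apply_bcontfun f x \<partial>\<nu>))"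
  proof (rule riesz_markov_complex[OF compact])
    fix f :: "'a \<Rightarrow>\<^sub>C complex" assume "range (apply_bcontfun f) \<subseteq> \<real>\<^sub>\<ge>\<^sub>0"
    then have nn: "apply_bcontfun (L f) x \<in> \<real>\<^sub>\<ge>\<^sub>0" for x using transfer_operator_nonneg by blast
    then have "0 \<le> (\<integral>x. Re (apply_bcontfun (L f) x) \<partial>\<mu>)"
      by (intro integral_nonneg_AE) (simp add: complex_nonneg_Reals_iff)
    moreover have "(\<integral>x. Im (apply_bcontfun (L f) x) \<partial>\<mu>) = 0"
      using nn by (simp add: complex_nonneg_Reals_iff)
    ultimately show "(\<integral>x. apply_bcontfun (L f) x \<partial>\<mu>) \<in> \<real>\<^sub>\<ge>\<^sub>0"
      using int[of "L f"] by (simp add: complex_nonneg_Reals_iff)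
  next
    show "(\<integral>x. apply_bcontfun (L (const_bcontfun 1)) x \<partial>\<mu>) = 1"
      by (simp add: transfer_operator_one prob_space)
  next
    show "(\<integral>x. apply_bcontfun (L (f + g)) x \<partial>\<mu>)
        = (\<integral>x. apply_bcontfun (L f) x \<partial>\<mu>) + (\<integral>x. apply_bcontfun (L g) x \<partial>\<mu>)" for f g
      by (simp add: transfer_operator_add int)
  next
    show "(\<integral>x. apply_bcontfun (L (cscale c f)) x \<partial>\<mu>) = c * (\<integral>x. apply_bcontfun (L f) x \<partial>\<mu>)" for c f
      by (simp add: transfer_operator_cscale)
  qed
  moreover have "(\<forall>f. (\<integral>x. apply_bcontfun (L f) x \<partial>\<mu>) = (\<integral>x. apply_bcontfun f x \<partial>\<nu>)) \<longleftrightarrow>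
      (\<forall>f. (\<integral>x. apply_bcontfun f x \<partial>\<nu>) = (\<integral>x. apply_bcontfun (L f) x \<partial>\<mu>))" for \<nu>
    by metis
  ultimately have "\<exists>!\<nu>. \<nu> \<in> borel_prob_measures \<and>
      (\<forall>f. (\<integral>x. apply_bcontfun f x \<partial>\<nu>) = (\<integral>x. apply_bcontfun (L f) x \<partial>\<mu>))"
    by simp
  from theI'[OF this] show ?thesis unfolding dual_transfer_operator_def by blast
qed

text \<open>
  On an open set \<open>U\<close> the map \<open>x \<mapsto> P(x, U)\<close> is a pointwise limit of the continuous functions \<open>L (G n)\<close>,
  and the open sets are an intersection-stable generator of the Borel sets.
\<close>
lemma measurable_transfer_kernel: "transfer_kernel L \<in> borel \<rightarrow>\<^sub>M prob_algebra borel"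
proof (rule measurable_prob_algebra_generated[where \<Omega> = UNIV and G = "Collect open"])
  show "sets borel = sigma_sets UNIV (Collect open :: 'a set set)" by (simp add: borel_def)
  show "Int_stable (Collect open :: 'a set set)" by (auto simp: Int_stable_def)
  show "prob_space (transfer_kernel L x)" "sets (transfer_kernel L x) = sets borel" for x
    using transfer_kernel_prob[of x] by (auto simp: borel_prob_measures_def)
  fix U :: "'a set" assume "U \<in> Collect open"
  then obtain G :: "nat \<Rightarrow> 'a \<Rightarrow>\<^sub>C complex" where
    "\<And>\<nu>. \<nu> \<in> borel_prob_measures \<Longrightarrow> (\<lambda>n. Re (\<integral>x. apply_bcontfun (G n) x \<partial>\<nu>)) \<longlonglongrightarrow> measure \<nu> U"
    using open_measure_limit by blast
  from this[OF transfer_kernel_prob]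
  have lim: "(\<lambda>n. Re (apply_bcontfun (L (G n)) x)) \<longlonglongrightarrow> measure (transfer_kernel L x) U" for x
    by (simp add: transfer_kernel_integral)
  have "(\<lambda>x. measure (transfer_kernel L x) U) \<in> borel_measurable borel"
  proof (rule borel_measurable_LIMSEQ_real[OF lim])
    show "(\<lambda>x. Re (apply_bcontfun (L (G n)) x)) \<in> borel_measurable borel" for n
      by (intro borel_measurable_continuous_onI continuous_intros continuous_on_apply_bcontfun)
  qed
  moreover have "emeasure (transfer_kernel L x) U = ennreal (measure (transfer_kernel L x) U)" for x
    using \<open>prob_space (transfer_kernel L x)\<close>
    by (simp add: finite_measure.emeasure_eq_measure prob_space_def)
  ultimately show "(\<lambda>x. emeasure (transfer_kernel L x) U) \<in> borel_measurable borel" by simp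
qed auto

text \<open>
  Both measures integrate every continuous function alike, and that determines them. This carries the
  invariance over from continuous to bounded measurable functions.
\<close>
lemma bind_transfer_kernel:
  assumes \<mu>: "\<mu> \<in> borel_prob_measures" and fixed: "dual_transfer_operator L \<mu> = \<mu>"
  shows "\<mu> \<bind> transfer_kernel L = \<mu>"
proof (rule borel_prob_measures_eqI[OF _ \<mu>])
  interpret prob_space \<mu> using \<mu> by (simp add: borel_prob_measures_def)
  have sets: "sets \<mu> = sets borel" using \<mu> by (simp add: borel_prob_measures_def)
  have \<mu>': "\<mu> \<in> space (prob_algebra borel)"
    using \<mu> by (simp add: space_prob_algebra borel_prob_measures_def)
  show bind: "\<mu> \<bind> transfer_kernel L \<in> borel_prob_measures"
    unfolding borel_prob_measures_def
    using prob_space_bind'[OF \<mu>' measurable_transfer_kernel] sets_bind'[OF \<mu>' measurable_transfer_kernel]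
    by simp
  fix f :: "'a \<Rightarrow>\<^sub>C complex"
  have K: "transfer_kernel L \<in> \<mu> \<rightarrow>\<^sub>M subprob_algebra borel"
    using measurable_prob_algebraD[OF measurable_transfer_kernel] by (simp add: measurable_cong_sets[OF sets refl])
  have fin: "AE x in \<mu>. emeasure (transfer_kernel L x) (space (transfer_kernel L x)) \<le> ennreal 1"
    using transfer_kernel_prob by (auto simp: borel_prob_measures_def prob_space.emeasure_space_1)
  have part: "(\<integral>x. g x \<partial>(\<mu> \<bind> transfer_kernel L)) = (\<integral>x. \<integral>y. g y \<partial>transfer_kernel L x \<partial>\<mu>)"
    if g: "continuous_on UNIV g" for g :: "'a \<Rightarrow> real"
  proof -
    obtain B where "\<And>x. \<bar>g x\<bar> \<le> B"
      using compact_UNIV_bounded_range[OF compact g] by (auto simp: bounded_iff)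
    then show ?thesis
      using K fin g by (intro integral_bind[where K = borel and B = B and B' = 1]
          borel_measurable_continuous_onI finite_measure_axioms) auto
  qed
  have "integrable \<mu> (\<lambda>x. \<integral>y. apply_bcontfun f y \<partial>transfer_kernel L x)"
    using integrable_bcontfun[OF \<mu>, of "L f"] by (simp flip: transfer_kernel_integral)
  note int = this integrable_bcontfun[OF bind, of f] integrable_bcontfun[OF transfer_kernel_prob]
  have "(\<integral>x. apply_bcontfun f x \<partial>(\<mu> \<bind> transfer_kernel L)) = (\<integral>x. apply_bcontfun (L f) x \<partial>\<mu>)"
  proof (rule complex_eqI)
    show "Re (\<integral>x. apply_bcontfun f x \<partial>(\<mu> \<bind> transfer_kernel L)) = Re (\<integral>x. apply_bcontfun (L f) x \<partial>\<mu>)"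
      using int part[of "\<lambda>x. Re (apply_bcontfun f x)", OF continuous_on_Re[OF continuous_on_apply_bcontfun]]
      by (simp add: transfer_kernel_integral)
    show "Im (\<integral>x. apply_bcontfun f x \<partial>(\<mu> \<bind> transfer_kernel L)) = Im (\<integral>x. apply_bcontfun (L f) x \<partial>\<mu>)"
      using int part[of "\<lambda>x. Im (apply_bcontfun f x)", OF continuous_on_Im[OF continuous_on_apply_bcontfun]]
      by (simp add: transfer_kernel_integral)
  qed
  then show "(\<integral>x. apply_bcontfun f x \<partial>(\<mu> \<bind> transfer_kernel L)) = (\<integral>x. apply_bcontfun f x \<partial>\<mu>)"
    using dual_transfer_operator_integral[OF \<mu>, of f] fixed by simp
qed

lemma extended_transfer_operator_of_real:
  assumes "f \<in> borel_measurable borel"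
  shows "extended_transfer_operator L (\<lambda>y. complex_of_real (f y)) x =
    complex_of_real (\<integral>y. f y \<partial>transfer_kernel L x)"
  using assms L_infty_integral_eq[OF transfer_kernel_prob[of x], of "\<lambda>y. complex_of_real (f y)" "\<lambda>y. complex_of_real (f y)"]
  by (simp add: extended_transfer_operator_def)

lemma extended_transfer_operator_indicator:
  assumes "A \<in> sets borel"
  shows "extended_transfer_operator L (indicator A) x = complex_of_real (measure (transfer_kernel L x) A)"
proof -
  have ind: "(indicator A :: 'a \<Rightarrow> complex) = (\<lambda>y. complex_of_real (indicator A y))"
    by (auto simp: indicator_def)
  show ?thesis
    unfolding ind using assms space_borel_prob_measure[OF transfer_kernel_prob[of x]]
    by (subst extended_transfer_operator_of_real) auto
qed

end

section \<open>Hopf's maximal inequality for an invariant Markov kernel\<close>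

text \<open>
  The measure \<open>\<mu>\<close> also serves as the measurable space on which the kernel lives, so that measurability
  always refers to the sets of \<open>\<mu>\<close>.
\<close>
locale invariant_markov_kernel = prob_space \<mu> for \<mu> :: "'a measure" +
  fixes K :: "'a \<Rightarrow> 'a measure"
  assumes kernel: "K \<in> \<mu> \<rightarrow>\<^sub>M prob_algebra \<mu>"
    and invariant: "\<mu> \<bind> K = \<mu>"
begin

lemma kernel_subprob [measurable]: "K \<in> \<mu> \<rightarrow>\<^sub>M subprob_algebra \<mu>"
  using kernel by (rule measurable_prob_algebraD)

lemma sets_kernel_eq: "x \<in> space \<mu> \<Longrightarrow> sets (K x) = sets \<mu>"
  and prob_space_kernel: "x \<in> space \<mu> \<Longrightarrow> prob_space (K x)"
  using measurable_space[OF kernel] by (auto simp: space_prob_algebra)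

lemma space_kernel: "x \<in> space \<mu> \<Longrightarrow> space (K x) = space \<mu>"
  using sets_eq_imp_space_eq[OF sets_kernel_eq] .

definition bounded_measurable :: "('a \<Rightarrow> real) \<Rightarrow> bool" where
  "bounded_measurable f \<longleftrightarrow> f \<in> borel_measurable \<mu> \<and> (\<exists>B. \<forall>x\<in>space \<mu>. \<bar>f x\<bar> \<le> B)"

definition transition :: "('a \<Rightarrow> real) \<Rightarrow> 'a \<Rightarrow> real" where
  "transition f x = (\<integral>y. f y \<partial>K x)"

lemma bounded_measurableD [dest]: "bounded_measurable f \<Longrightarrow> f \<in> borel_measurable \<mu>"
  by (simp add: bounded_measurable_def)

lemma bounded_measurable_const: "bounded_measurable (\<lambda>_. c)"
  by (auto simp: bounded_measurable_def)

lemma bounded_measurable_add: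
  assumes "bounded_measurable f" "bounded_measurable g"
  shows "bounded_measurable (\<lambda>x. f x + g x)"
proof -
  obtain B C where "\<forall>x\<in>space \<mu>. \<bar>f x\<bar> \<le> B" "\<forall>x\<in>space \<mu>. \<bar>g x\<bar> \<le> C"
    using assms unfolding bounded_measurable_def by blast
  then have "\<forall>x\<in>space \<mu>. \<bar>f x + g x\<bar> \<le> B + C"
    by (meson abs_triangle_ineq add_mono order_trans)
  then show ?thesis using assms by (auto simp: bounded_measurable_def)
qed

lemma bounded_measurable_mult:
  assumes "bounded_measurable f" "bounded_measurable g"
  shows "bounded_measurable (\<lambda>x. f x * g x)"
proof -
  obtain B C where "\<forall>x\<in>space \<mu>. \<bar>f x\<bar> \<le> B" "\<forall>x\<in>space \<mu>. \<bar>g x\<bar> \<le> C"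
    using assms unfolding bounded_measurable_def by blast
  then have "\<forall>x\<in>space \<mu>. \<bar>f x * g x\<bar> \<le> B * C"
    unfolding abs_mult by (auto intro!: mult_mono intro: order_trans[OF abs_ge_zero])
  then show ?thesis using assms by (auto simp: bounded_measurable_def)
qed

lemma bounded_measurable_diff:
  "bounded_measurable f \<Longrightarrow> bounded_measurable g \<Longrightarrow> bounded_measurable (\<lambda>x. f x - g x)"
  using bounded_measurable_add[of f "\<lambda>x. -1 * g x"]
    bounded_measurable_mult[OF bounded_measurable_const, of g "-1"] by simp

lemma bounded_measurable_sum:
  "(\<And>i. i \<in> I \<Longrightarrow> bounded_measurable (f i)) \<Longrightarrow> bounded_measurable (\<lambda>x. \<Sum>i\<in>I. f i x)"
  by (induction I rule: infinite_finite_induct)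
    (auto simp: bounded_measurable_const bounded_measurable_add)

lemma bounded_measurable_max_0:
  "bounded_measurable f \<Longrightarrow> bounded_measurable (\<lambda>x. max 0 (f x))"
  unfolding bounded_measurable_def by (force simp: max_def)

lemma bounded_measurable_indicator: "A \<in> sets \<mu> \<Longrightarrow> bounded_measurable (indicator A)"
  unfolding bounded_measurable_def by (auto intro!: exI[of _ 1] simp: indicator_def)

lemma integrable_bounded_measurable: "bounded_measurable f \<Longrightarrow> integrable \<mu> f"
  unfolding bounded_measurable_def using integrable_const_bound[of f] by (metis AE_I2 real_norm_def)

lemma integrable_kernel:
  assumes "bounded_measurable f" "x \<in> space \<mu>"
  shows "integrable (K x) f"
proof -
  interpret K: prob_space "K x" by (rule prob_space_kernel) fact
  obtain B where "\<forall>x\<in>space \<mu>. \<bar>f x\<bar> \<le> B" "f \<in> borel_measurable \<mu>"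
    using assms(1) by (auto simp: bounded_measurable_def)
  then show ?thesis
    using assms(2) measurable_cong_sets[OF sets_kernel_eq refl]
    by (intro K.integrable_const_bound[of _ B]) (auto simp: space_kernel)
qed

lemma bounded_measurable_transition:
  assumes "bounded_measurable f"
  shows "bounded_measurable (transition f)"
proof -
  obtain B where B: "\<And>x. x \<in> space \<mu> \<Longrightarrow> \<bar>f x\<bar> \<le> B" and [measurable]: "f \<in> borel_measurable \<mu>"
    using assms by (auto simp: bounded_measurable_def)
  have "\<bar>transition f x\<bar> \<le> B" if x: "x \<in> space \<mu>" for x
  proof -
    interpret K: prob_space "K x" by (rule prob_space_kernel) fact
    have "\<bar>transition f x\<bar> \<le> (\<integral>y. \<bar>f y\<bar> \<partial>K x)"
      unfolding transition_def by (rule integral_abs_bound)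
    also have "\<dots> \<le> B"
      using integrable_kernel[OF assms x] B x
      by (intro K.integral_le_const) (auto simp: space_kernel)
    finally show ?thesis .
  qed
  moreover have "transition f \<in> borel_measurable \<mu>"
    unfolding transition_def by measurable
  ultimately show ?thesis by (auto simp: bounded_measurable_def)
qed

lemma integral_transition:
  assumes "bounded_measurable f"
  shows "(\<integral>x. transition f x \<partial>\<mu>) = (\<integral>x. f x \<partial>\<mu>)"
proof -
  obtain B where B: "\<And>x. x \<in> space \<mu> \<Longrightarrow> \<bar>f x\<bar> \<le> B" and f: "f \<in> borel_measurable \<mu>"
    using assms by (auto simp: bounded_measurable_def)
  have "AE x in \<mu>. emeasure (K x) (space (K x)) \<le> ennreal 1"
    using prob_space.emeasure_space_1[OF prob_space_kernel] by auto
  from integral_bind[OF f B kernel_subprob finite_measure_axioms this]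
  show ?thesis by (simp add: invariant transition_def)
qed

text \<open>
  For almost every \<open>x\<close> the measure \<open>K x\<close> lives on \<open>A\<close> if \<open>x \<in> A\<close> and off \<open>A\<close> otherwise. So multiplication with
  the indicator of \<open>A\<close> commutes almost everywhere with averaging over the kernel, and the invariance of
  \<open>\<mu>\<close> localises to \<open>A\<close>.
\<close>
lemma integral_transition_on_invariant_set:
  assumes f: "bounded_measurable f" and A: "A \<in> sets \<mu>"
    and inv: "AE x in \<mu>. measure (K x) A = indicator A x"
  shows "(\<integral>x. indicator A x * transition f x \<partial>\<mu>) = (\<integral>x. indicator A x * f x \<partial>\<mu>)"
proof -
  have bm: "bounded_measurable (\<lambda>x. indicator A x * f x)"
    by (intro bounded_measurable_mult bounded_measurable_indicator f A)
  have "AE x in \<mu>. indicator A x * transition f x = transition (\<lambda>y. indicator A y * f y) x"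
    using inv AE_space
  proof eventually_elim
    fix x assume Kx: "measure (K x) A = indicator A x" and x: "x \<in> space \<mu>"
    interpret K: prob_space "K x" by (rule prob_space_kernel) fact
    have [measurable]: "A \<in> sets (K x)" using A x by (simp add: sets_kernel_eq)
    have [measurable]: "f \<in> borel_measurable (K x)"
      using f measurable_cong_sets[OF sets_kernel_eq[OF x] refl] by blast
    have "AE y in K x. y \<in> A \<longleftrightarrow> x \<in> A"
    proof (cases "x \<in> A")
      case True
      then have "AE y in K x. y \<in> A" using Kx by (intro K.AE_prob_1) simp
      with True show ?thesis by simp
    next
      case False
      then have "AE y in K x. y \<notin> A"
        using Kx A x by (subst K.prob_eq_0[symmetric]) (auto simp: sets_kernel_eq)
      with False show ?thesis by simp
    qed
    then have "AE y in K x. indicator A y * f y = indicator A x * f y"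
      by eventually_elim (auto simp: indicator_def)
    then have "transition (\<lambda>y. indicator A y * f y) x = (\<integral>y. indicator A x * f y \<partial>K x)"
      unfolding transition_def by (intro integral_cong_AE) measurable
    then show "indicator A x * transition f x = transition (\<lambda>y. indicator A y * f y) x"
      by (simp add: transition_def)
  qed
  then have "(\<integral>x. indicator A x * transition f x \<partial>\<mu>) = (\<integral>x. transition (\<lambda>y. indicator A y * f y) x \<partial>\<mu>)"
    using bounded_measurable_transition[OF bm] bounded_measurable_transition[OF f] A
    by (intro integral_cong_AE) auto
  also have "\<dots> = (\<integral>x. indicator A x * f x \<partial>\<mu>)"
    by (rule integral_transition[OF bm])
  finally show ?thesis .
qed

lemma bounded_measurable_transition_power: "bounded_measurable f \<Longrightarrow> bounded_measurable ((transition ^^ j) f)"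
  by (induction j) (auto intro: bounded_measurable_transition)

text \<open>
  This is \<open>max {0, \<psi>\<^sub>1, \<dots>, \<psi>\<^sub>N}\<close> in the classical proofs of Hopf's maximal ergodic theorem, for the sums
  \<open>\<psi>\<^sub>n\<close> of the first \<open>n\<close> iterates of \<open>\<psi>\<close>, with the maximum taken after averaging replaced by
  one taken before it. The recursion (that of the value function of a stopping problem) dominates
  every \<open>\<psi>\<^sub>n\<close> with \<open>n \<le> N\<close>, which is all that the maximum is needed for, and it turns Hopf's inequality on
  the set of positive values into an equation.
\<close>
primrec maximal_excess :: "('a \<Rightarrow> real) \<Rightarrow> nat \<Rightarrow> 'a \<Rightarrow> real" where
  "maximal_excess \<psi> 0 = (\<lambda>x. 0)"
| "maximal_excess \<psi> (Suc N) = (\<lambda>x. max 0 (\<psi> x + transition (maximal_excess \<psi> N) x))"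

lemma bounded_measurable_maximal_excess:
  "bounded_measurable \<psi> \<Longrightarrow> bounded_measurable (maximal_excess \<psi> N)"
  by (induction N)
    (auto intro!: bounded_measurable_const bounded_measurable_max_0 bounded_measurable_add bounded_measurable_transition)

lemma transition_mono:
  assumes "bounded_measurable f" "bounded_measurable g" "\<And>y. y \<in> space \<mu> \<Longrightarrow> f y \<le> g y" "x \<in> space \<mu>"
  shows "transition f x \<le> transition g x"
  unfolding transition_def using assms by (intro integral_mono integrable_kernel) (auto simp: space_kernel)

lemma maximal_excess_nonneg: "0 \<le> maximal_excess \<psi> N x"
  by (cases N) auto

lemma maximal_excess_mono_Suc:
  assumes \<psi>: "bounded_measurable \<psi>" and x: "x \<in> space \<mu>"
  shows "maximal_excess \<psi> N x \<le> maximal_excess \<psi> (Suc N) x"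
  using x
proof (induction N arbitrary: x)
  case (Suc N)
  then have "transition (maximal_excess \<psi> N) x \<le> transition (maximal_excess \<psi> (Suc N)) x"
    by (intro transition_mono bounded_measurable_maximal_excess \<psi>) auto
  then show ?case by (simp add: max_def)
qed auto

lemma maximal_excess_mono:
  assumes "bounded_measurable \<psi>" "x \<in> space \<mu>" "m \<le> n"
  shows "maximal_excess \<psi> m x \<le> maximal_excess \<psi> n x"
  by (rule lift_Suc_mono_le[where f = "\<lambda>n. maximal_excess \<psi> n x", OF _ assms(3)])
    (rule maximal_excess_mono_Suc[OF assms(1,2)])

text \<open>
  The left-hand sides satisfy the recursion of the maximal excess without the maximum with 0, and averaging over
  the kernel is monotone.
\<close>
lemma excess_le_maximal_excess:
  assumes \<phi>: "bounded_measurable \<phi>" and x: "x \<in> space \<mu>"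
  shows "real n * \<beta> - (\<Sum>j<n. (transition ^^ j) \<phi> x) \<le> maximal_excess (\<lambda>x. \<beta> - \<phi> x) n x"
  using x
proof (induction n arbitrary: x)
  case (Suc n)
  let ?S = "\<lambda>y. \<Sum>j<n. (transition ^^ j) \<phi> y"
  let ?m = "maximal_excess (\<lambda>x. \<beta> - \<phi> x)"
  interpret K: prob_space "K x" by (rule prob_space_kernel) fact
  have int: "integrable (K x) ((transition ^^ j) \<phi>)" for j
    by (intro integrable_kernel bounded_measurable_transition_power \<phi> Suc.prems)
  have \<psi>: "bounded_measurable (\<lambda>x. \<beta> - \<phi> x)"
    by (intro bounded_measurable_diff bounded_measurable_const \<phi>)
  have "(\<Sum>j<Suc n. (transition ^^ j) \<phi> x) = \<phi> x + transition ?S x"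
    unfolding sum.lessThan_Suc_shift using int by (simp add: transition_def)
  moreover have "real n * \<beta> - transition ?S x = transition (\<lambda>y. real n * \<beta> - ?S y) x"
    using int by (simp add: transition_def K.prob_space)
  moreover have "transition (\<lambda>y. real n * \<beta> - ?S y) x \<le> transition (?m n) x"
    using Suc by (intro transition_mono bounded_measurable_maximal_excess \<psi> bounded_measurable_diff
        bounded_measurable_const bounded_measurable_sum bounded_measurable_transition_power \<phi>)
  ultimately have "real (Suc n) * \<beta> - (\<Sum>j<Suc n. (transition ^^ j) \<phi> x) \<le> \<beta> - \<phi> x + transition (?m n) x"
    by (simp add: algebra_simps)
  then show ?case by simp
qed auto

text \<open>
  Hopf's maximal inequality, localised to an invariant set. Where the \<open>N\<close>-th maximal excess \<open>m N\<close> is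
  positive, \<open>\<psi> = m N - transition (m (N - 1))\<close> by the recursion; elsewhere that difference is not
  positive. So the integral of \<open>\<psi>\<close> over the part of \<open>A\<close> in the positivity set is at least the integral
  over \<open>A\<close> of this difference, which is that of \<open>m N - m (N - 1) \<ge> 0\<close> by invariance.
\<close>
lemma integral_maximal_excess_pos_set_nonneg:
  assumes \<psi>: "bounded_measurable \<psi>" and A: "A \<in> sets \<mu>"
    and inv: "AE x in \<mu>. measure (K x) A = indicator A x"
  shows "0 \<le> (\<integral>x. indicator A x * (indicator {x\<in>space \<mu>. 0 < maximal_excess \<psi> N x} x * \<psi> x) \<partial>\<mu>)"
proof (cases N)
  case (Suc N')
  let ?m = "maximal_excess \<psi>"
  let ?E = "{x\<in>space \<mu>. 0 < ?m N x}"
  note bm = bounded_measurable_maximal_excess[OF \<psi>]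
  have [measurable]: "?m n \<in> borel_measurable \<mu>" for n using bm by blast
  have E: "?E \<in> sets \<mu>" by measurable
  have transition_nonneg: "0 \<le> transition (?m N') x" for x
    unfolding transition_def by (intro integral_nonneg_AE) (simp add: maximal_excess_nonneg)
  have "(\<integral>x. indicator A x * ?m N' x \<partial>\<mu>) \<le> (\<integral>x. indicator A x * ?m N x \<partial>\<mu>)"
    unfolding Suc using maximal_excess_mono_Suc[OF \<psi>]
    by (intro integral_mono integrable_bounded_measurable bounded_measurable_mult
        bounded_measurable_indicator A bm mult_left_mono) auto
  then have "0 \<le> (\<integral>x. indicator A x * ?m N x \<partial>\<mu>) - (\<integral>x. indicator A x * transition (?m N') x \<partial>\<mu>)"
    using integral_transition_on_invariant_set[OF bm A inv] by simp
  also have "\<dots> = (\<integral>x. indicator A x * ?m N x - indicator A x * transition (?m N') x \<partial>\<mu>)"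
    by (intro Bochner_Integration.integral_diff[symmetric] integrable_bounded_measurable
        bounded_measurable_mult bounded_measurable_indicator A bm bounded_measurable_transition)
  also have "\<dots> \<le> (\<integral>x. indicator A x * (indicator ?E x * \<psi> x) \<partial>\<mu>)"
  proof (rule integral_mono)
    fix x assume x: "x \<in> space \<mu>"
    have "?m N x - transition (?m N') x \<le> indicator ?E x * \<psi> x"
    proof (cases "0 < ?m N x")
      case True
      then have "?m N x = \<psi> x + transition (?m N') x" by (simp add: Suc max_def split: if_splits)
      then show ?thesis using True x by simp
    next
      case False
      then show ?thesis using transition_nonneg[of x] by simp
    qed
    then show "indicator A x * ?m N x - indicator A x * transition (?m N') x
        \<le> indicator A x * (indicator ?E x * \<psi> x)"
      by (simp add: indicator_def)
  qed (intro integrable_bounded_measurable bounded_measurable_diff bounded_measurable_mult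
        bounded_measurable_indicator A E bm \<psi> bounded_measurable_transition)+
  finally show ?thesis .
qed simp

text \<open>
  For \<open>\<psi> = \<beta> - \<phi>\<close> the positivity sets of the maximal excess exhaust \<open>A\<close> by hypothesis, and dominated
  convergence lets \<open>N\<close> tend to infinity in the maximal inequality.
\<close>
theorem integral_le_of_ergodic_averages_below:
  assumes \<phi>: "bounded_measurable \<phi>" and A: "A \<in> sets \<mu>"
    and inv: "AE x in \<mu>. measure (K x) A = indicator A x"
    and below: "\<And>x. x \<in> A \<Longrightarrow> \<exists>n. (\<Sum>j<n. (transition ^^ j) \<phi> x) < real n * \<beta>"
  shows "(\<integral>x. indicator A x * \<phi> x \<partial>\<mu>) \<le> \<beta> * measure \<mu> A"
proof -
  define \<psi> where "\<psi> x = \<beta> - \<phi> x" for x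
  let ?m = "maximal_excess \<psi>"
  let ?E = "\<lambda>N. {x\<in>space \<mu>. 0 < ?m N x}"
  have \<psi>: "bounded_measurable \<psi>"
    unfolding \<psi>_def by (intro bounded_measurable_diff bounded_measurable_const \<phi>)
  then have [measurable]: "\<psi> \<in> borel_measurable \<mu>" "?m N \<in> borel_measurable \<mu>" for N
    using bounded_measurable_maximal_excess by blast+
  have [measurable]: "A \<in> sets \<mu>" by fact
  have lim: "(\<lambda>N. \<integral>x. indicator A x * (indicator (?E N) x * \<psi> x) \<partial>\<mu>)
      \<longlonglongrightarrow> (\<integral>x. indicator A x * \<psi> x \<partial>\<mu>)"
  proof (rule integral_dominated_convergence[where w = "\<lambda>x. \<bar>\<psi> x\<bar>"])
    show "AE x in \<mu>. (\<lambda>N. indicator A x * (indicator (?E N) x * \<psi> x)) \<longlonglongrightarrow> indicator A x * \<psi> x"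
    proof (intro AE_I2)
      fix x assume x: "x \<in> space \<mu>"
      show "(\<lambda>N. indicator A x * (indicator (?E N) x * \<psi> x)) \<longlonglongrightarrow> indicator A x * \<psi> x"
      proof (cases "x \<in> A")
        case True
        then obtain n where "(\<Sum>j<n. (transition ^^ j) \<phi> x) < real n * \<beta>" using below by blast
        then have "0 < ?m n x"
          using excess_le_maximal_excess[OF \<phi> x, of n \<beta>] by (simp flip: \<psi>_def)
        then have "0 < ?m N x" if "n \<le> N" for N
          using maximal_excess_mono[OF \<psi> x that] by simp
        then have "\<forall>\<^sub>F N in sequentially. indicator A x * (indicator (?E N) x * \<psi> x) = indicator A x * \<psi> x"
          using x by (auto simp: eventually_sequentially intro!: exI[of _ n])
        then show ?thesis by (rule tendsto_eventually)
      qed simp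
    qed
    show "AE x in \<mu>. norm (indicator A x * (indicator (?E N) x * \<psi> x)) \<le> \<bar>\<psi> x\<bar>" for N
      by (auto simp: indicator_def)
    show "integrable \<mu> (\<lambda>x. \<bar>\<psi> x\<bar>)"
      using integrable_bounded_measurable[OF \<psi>] by simp
  qed measurable
  have "0 \<le> (\<integral>x. indicator A x * \<psi> x \<partial>\<mu>)"
    using integral_maximal_excess_pos_set_nonneg[OF \<psi> A inv]
    by (intro LIMSEQ_le_const[OF lim]) blast
  also have "\<dots> = (\<integral>x. \<beta> * indicator A x - indicator A x * \<phi> x \<partial>\<mu>)"
    by (rule Bochner_Integration.integral_cong) (auto simp: \<psi>_def algebra_simps)
  also have "\<dots> = (\<integral>x. \<beta> * indicator A x \<partial>\<mu>) - (\<integral>x. indicator A x * \<phi> x \<partial>\<mu>)"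
    by (intro Bochner_Integration.integral_diff integrable_bounded_measurable bounded_measurable_mult
        bounded_measurable_const bounded_measurable_indicator A \<phi>)
  also have "(\<integral>x. \<beta> * indicator A x \<partial>\<mu>) = \<beta> * measure \<mu> A"
    using A sets.sets_into_space[OF A] by (simp add: Int_absorb2)
  finally show ?thesis by simp
qed

end

section \<open>The inequality for transfer operators\<close>

theorem corollary2:
  fixes L :: "('a::metric_space \<Rightarrow>\<^sub>C complex) \<Rightarrow> ('a \<Rightarrow>\<^sub>C complex)"
    and \<mu> :: "'a measure" and \<phi> :: "'a \<Rightarrow> real" and \<beta> :: real and A :: "'a set"
  assumes "compact (UNIV :: 'a set)"
    and "transfer_operator L"
    and "\<mu> \<in> borel_prob_measures"
    and "dual_transfer_operator L \<mu> = \<mu>"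
    and "bounded (range \<phi>)"
    and "\<phi> \<in> borel_measurable borel"
    and "A \<in> sets borel"
    and "A \<subseteq> sublevel_set L \<phi> \<beta>"
    and "AE x in \<mu>. extended_transfer_operator L (indicator A) x = indicator A x"
  shows "(LINT x:A|\<mu>. \<phi> x) \<le> \<beta> * measure \<mu> A"
proof -
  note L = \<open>compact UNIV\<close> \<open>transfer_operator L\<close>
  have sets: "sets \<mu> = sets borel" and "prob_space \<mu>"
    using \<open>\<mu> \<in> borel_prob_measures\<close> by (auto simp: borel_prob_measures_def)
  interpret prob_space \<mu> by fact
  interpret invariant_markov_kernel \<mu> "transfer_kernel L"
  proof
    show "transfer_kernel L \<in> \<mu> \<rightarrow>\<^sub>M prob_algebra \<mu>"
      using measurable_transfer_kernel[OF L]
      by (simp add: measurable_cong_sets[OF sets refl] prob_algebra_def subprob_algebra_cong[OF sets])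
    show "\<mu> \<bind> transfer_kernel L = \<mu>"
      by (intro bind_transfer_kernel L assms)
  qed
  have borel: "f \<in> borel_measurable \<mu> \<longleftrightarrow> f \<in> borel_measurable borel" for f :: "'a \<Rightarrow> real"
    by (simp add: measurable_cong_sets[OF sets refl])
  have \<phi>: "bounded_measurable \<phi>"
    using \<open>bounded (range \<phi>)\<close> \<open>\<phi> \<in> borel_measurable borel\<close>
    by (auto simp: bounded_measurable_def borel bounded_iff)
  have iterate: "(extended_transfer_operator L ^^ j) (\<lambda>y. complex_of_real (\<phi> y))
      = (\<lambda>y. complex_of_real ((transition ^^ j) \<phi> y))" for j
  proof (induction j)
    case (Suc j)
    have "(transition ^^ j) \<phi> \<in> borel_measurable borel"
      using bounded_measurable_transition_power[OF \<phi>, of j] by (auto simp: bounded_measurable_def borel)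
    then show ?case
      by (simp add: Suc extended_transfer_operator_of_real[OF L] flip: transition_def)
  qed simp
  have ergodic_sum: "ergodic_sum L \<phi> n x = (\<Sum>j<n. (transition ^^ j) \<phi> x)" for n x
    by (simp add: ergodic_sum_def iterate)
  have "AE x in \<mu>. measure (transfer_kernel L x) A = indicator A x"
    using assms(9)
  proof eventually_elim
    case (elim x)
    then have "complex_of_real (measure (transfer_kernel L x) A) = complex_of_real (indicator A x)"
      by (simp add: extended_transfer_operator_indicator[OF L \<open>A \<in> sets borel\<close>] indicator_def)
    then show ?case by (simp only: of_real_eq_iff)
  qed
  moreover have "\<exists>n. (\<Sum>j<n. (transition ^^ j) \<phi> x) < real n * \<beta>" if "x \<in> A" for x
  proof (rule ccontr)
    assume none: "\<not> ?thesis"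
    \<comment> \<open>The infimum of a set of reals is meaningful only if the set is bounded below; in the proof by contradiction,
      \<open>\<beta>\<close> is such a bound.\<close>
    have "\<beta> \<le> (INF n\<in>{1..}. ergodic_sum L \<phi> n x / real n)"
    proof (rule cINF_greatest)
      fix n :: nat assume "n \<in> {1..}"
      then show "\<beta> \<le> ergodic_sum L \<phi> n x / real n"
        using none by (simp add: ergodic_sum not_less field_simps)
    qed simp
    then show False
      using that \<open>A \<subseteq> sublevel_set L \<phi> \<beta>\<close> by (auto simp: sublevel_set_def)
  qed
  ultimately have "(\<integral>x. indicator A x * \<phi> x \<partial>\<mu>) \<le> \<beta> * measure \<mu> A"
    using \<open>A \<in> sets borel\<close> by (intro integral_le_of_ergodic_averages_below[OF \<phi>]) (auto simp: sets)
  then show ?thesis by (simp add: set_lebesgue_integral_def)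
qed

end
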